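(* Let $\nu\in\mathbb{R}$, $\nu\neq 2$, and consider, with constant timestep $k>0$, the 2-step method $$\frac{1}{1-\frac{\nu}{2}}y_{n+1}-\frac{1+\frac{\nu}{2}}{1-\frac{\nu}{2}}y_n+\frac{\frac{\nu}{2}}{1-\frac{\nu}{2}}y_{n-1}=k f\!\left(t_{n+1},\ \frac{1}{1-\frac{\nu}{2}}y_{n+1}-\frac{\nu}{1-\frac{\nu}{2}}y_n+\frac{\frac{\nu}{2}}{1-\frac{\nu}{2}}y_{n-1}\right)$$ for $y'(t)=f(t,y(t))$. The method is $0$-stable for $-2\leq\nu<2$ and $0$-unstable otherwise. Moreover, for $-2\leq \nu<2$, the method is $A$-stable for $-\frac{2}{3}\leq\nu\leq\frac{2}{3}$.
   Context: Here $t_{n+1}=t_n+k$. For a 2-step method $\alpha_2y_{n+1}+\alpha_1y_n+\alpha_0y_{n-1}=k f(t_{n+1},\beta_2y_{n+1}+\beta_1y_n+\beta_0y_{n-1})$, $0$-stability means the root condition: all roots of $\alpha_2z^2+\alpha_1z+\alpha_0$ satisfy $|z|\le 1$, and roots with $|z|=1$ are simple; the method is $0$-unstable if this fails. $A$-stability (constant timestep) has its standard meaning: for every $\lambda\in\mathbb{C}$ with $\mathrm{Re}(\lambda)\leq 0$ and every $k>0$, all solutions $(y_n)$ of the method applied to $y'=\lambda y$ are bounded. *)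

theory Defs
  imports "HOL-Analysis.Analysis" "HOL-Computational_Algebra.Polynomial"
begin

record two_step_method =
  alpha2 :: real
  alpha1 :: real
  alpha0 :: real
  beta2 :: real
  beta1 :: real
  beta0 :: real

text \<open>A numerical solution with constant timestep \<open>k\<close> for \<open>y'(t) = f(t, y(t))\<close>,
  on the time grid \<open>t\<^sub>n = t0 + n k\<close>. The starting values \<open>y 0\<close> and \<open>y 1\<close> are arbitrary.\<close>

definition numerical_solution ::
  "two_step_method \<Rightarrow> real \<Rightarrow> real \<Rightarrow> (real \<Rightarrow> 'a::real_vector \<Rightarrow> 'a) \<Rightarrow> (nat \<Rightarrow> 'a) \<Rightarrow> bool"
where
  "numerical_solution M k t0 f y \<longleftrightarrow>
    (\<forall>n\<ge>1. alpha2 M *\<^sub>R y (n + 1) + alpha1 M *\<^sub>R y n + alpha0 M *\<^sub>R y (n - 1) =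
       k *\<^sub>R f (t0 + real (n + 1) * k)
         (beta2 M *\<^sub>R y (n + 1) + beta1 M *\<^sub>R y n + beta0 M *\<^sub>R y (n - 1)))"

definition first_char_poly :: "two_step_method \<Rightarrow> complex poly" where
  "first_char_poly M = [:of_real (alpha0 M), of_real (alpha1 M), of_real (alpha2 M):]"

definition zero_stable :: "two_step_method \<Rightarrow> bool" where
  "zero_stable M \<longleftrightarrow>
    (\<forall>z. poly (first_char_poly M) z = 0 \<longrightarrow>
       norm z \<le> 1 \<and> (norm z = 1 \<longrightarrow> order z (first_char_poly M) = 1))"

abbreviation zero_unstable :: "two_step_method \<Rightarrow> bool" where
  "zero_unstable M \<equiv> \<not> zero_stable M"

definition A_stable :: "two_step_method \<Rightarrow> bool" where
  "A_stable M \<longleftrightarrow>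
    (\<forall>(c::complex) k t0 y. Re c \<le> 0 \<longrightarrow> k > 0 \<longrightarrow>
       numerical_solution M k t0 (\<lambda>t u. c * u) y \<longrightarrow> bounded (range y))"

definition nu_method :: "real \<Rightarrow> two_step_method" where
  "nu_method \<nu> =
    \<lparr> alpha2 = 1 / (1 - \<nu> / 2),
      alpha1 = - ((1 + \<nu> / 2) / (1 - \<nu> / 2)),
      alpha0 = (\<nu> / 2) / (1 - \<nu> / 2),
      beta2 = 1 / (1 - \<nu> / 2),
      beta1 = - (\<nu> / (1 - \<nu> / 2)),
      beta0 = (\<nu> / 2) / (1 - \<nu> / 2) \<rparr>"

end

theory Submission
  imports Defs
begin

text \<open>
  Write \<open>a = \<nu>/2\<close>. The first characteristic polynomial is, up to a nonzero factor,
  \<open>(z - 1) (z - a)\<close>, with distinct roots because \<open>a \<noteq> 1\<close>. So the root condition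
  just says \<open>\<bar>a\<bar> \<le> 1\<close>.

  For \<open>A\<close>-stability put \<open>\<mu> = k c\<close>, where \<open>y' = c y\<close>. The method becomes the recurrence with
  characteristic equation \<open>z\<^sup>2 - s z + a = 0\<close>, where \<open>s = 2 a + (1 - a) / (1 - \<mu>)\<close>. The
  position of \<open>s\<close> relative to an ellipse decides whether the roots lie in the unit disc:

  \<^item> The product of the roots is \<open>a\<close>, so a root \<open>z\<close> gives \<open>s = z + a / z\<close>. This Joukowski map
    sends the circle of radius \<open>r > 1\<close> to an ellipse strictly outside the one with semi-axes
    \<open>1 + a\<close> and \<open>1 - a\<close>, which is the image of the unit circle. Hence \<open>s\<close> in the latter, filled,
    ellipse forces both roots into the closed unit disc
    (\<open>norm_le_1_if_coeff_in_ellipse\<close>).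

  \<^item> The half-plane \<open>Re \<mu> \<le> 0\<close> is mapped by \<open>1 / (1 - \<mu>)\<close> into the disc with diameter
    \<open>[0, 1]\<close>. The resulting disc of values \<open>s\<close> touches the ellipse at \<open>1 + a\<close>, and lies inside it
    when \<open>\<bar>a\<bar> \<le> 1/3\<close> (\<open>disc_in_ellipse\<close>).

  Since the product of the roots has modulus less than \<open>1\<close>, at most one of them lies on the unit
  circle, and the recurrence is bounded (\<open>bounded_recurrence\<close>).
\<close>

text \<open>
  The recurrence factors into two of first order: \<open>u (n + 1) - z2 u n\<close> is geometric with ratio
  \<open>z1\<close>, hence bounded, and it drives a contraction with factor \<open>z2\<close>. No case distinction for
  \<open>z1 = z2\<close> arises, as it would for the explicit solution.
\<close>

lemma bounded_recurrence:
  fixes u :: "nat \<Rightarrow> 'a::real_normed_field"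
  assumes rec: "\<And>n. u (Suc (Suc n)) = (z1 + z2) * u (Suc n) - z1 * z2 * u n"
    and z1: "norm z1 \<le> 1" and z2: "norm z2 < 1"
  shows "bounded (range u)"
proof -
  define v where "v n = u (Suc n) - z2 * u n" for n
  have v_Suc: "v (Suc n) = z1 * v n" for n
    by (simp add: v_def rec algebra_simps)
  have v_le: "norm (v n) \<le> norm (v 0)" for n
  proof (induction n)
    case (Suc n)
    have "norm (v (Suc n)) = norm z1 * norm (v n)"
      by (simp add: v_Suc norm_mult)
    also have "\<dots> \<le> 1 * norm (v n)"
      using z1 by (intro mult_right_mono) auto
    finally show ?case using Suc by simp
  qed simp
  \<comment> \<open>\<open>C\<close> is the fixed point of \<open>x \<mapsto> norm z2 * x + norm (v 0)\<close>; adding \<open>norm (u 0)\<close> covers the start.\<close>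
  define C where "C = norm (v 0) / (1 - norm z2)"
  define B where "B = norm (u 0) + C"
  have C: "(1 - norm z2) * C = norm (v 0)" and "C \<ge> 0"
    using z2 by (auto simp: C_def)
  have B: "norm z2 * B + norm (v 0) \<le> B"
  proof -
    have "B - norm z2 * B = (1 - norm z2) * norm (u 0) + norm (v 0)"
      using C by (simp add: B_def algebra_simps)
    moreover have "(1 - norm z2) * norm (u 0) \<ge> 0"
      using z2 by (intro mult_nonneg_nonneg) auto
    ultimately show ?thesis by linarith
  qed
  have "norm (u n) \<le> B" for n
  proof (induction n)
    case 0
    show ?case using \<open>C \<ge> 0\<close> by (simp add: B_def)
  next
    case (Suc n)
    have "norm (u (Suc n)) = norm (z2 * u n + v n)"
      by (simp add: v_def)
    also have "\<dots> \<le> norm z2 * norm (u n) + norm (v n)"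
      by (metis norm_mult norm_triangle_ineq)
    also have "\<dots> \<le> norm z2 * B + norm (v 0)"
      using Suc v_le by (intro add_mono mult_left_mono) auto
    finally show ?case using B by linarith
  qed
  then show ?thesis by (auto simp: bounded_iff)
qed

lemma quadratic_roots_exist:
  fixes s p :: complex
  obtains z1 z2 where "z1 + z2 = s" "z1 * z2 = p"
proof
  define d where "d = csqrt (s\<^sup>2 - 4 * p)"
  have d: "d * d = s * s - 4 * p"
    by (metis d_def power2_csqrt power2_eq_square)
  show "(s + d) / 2 + (s - d) / 2 = s"
    by (simp add: field_simps)
  show "(s + d) / 2 * ((s - d) / 2) = p"
    using d by (simp add: field_simps)
qed

text \<open>
  A root with \<open>N = \<bar>z\<bar>\<^sup>2\<close> gives \<open>s = (1 + a/N) Re z + \<i> (1 - a/N) Im z\<close>. If \<open>N > 1\<close>, then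
  \<open>N (1 + a/N)\<^sup>2\<close> and \<open>N (1 - a/N)\<^sup>2\<close> exceed \<open>(1 + a)\<^sup>2\<close> and \<open>(1 - a)\<^sup>2\<close> by the same amount
  \<open>d = (N - 1) (1 - a\<^sup>2/N) > 0\<close>, so \<open>s\<close> lies strictly outside the ellipse.
\<close>

lemma norm_le_1_if_coeff_in_ellipse:
  fixes z w s :: complex and a :: real
  assumes sum: "z + w = s" and prod: "z * w = of_real a" and a: "\<bar>a\<bar> < 1"
    and s: "(1 - a)\<^sup>2 * (Re s)\<^sup>2 + (1 + a)\<^sup>2 * (Im s)\<^sup>2 \<le> (1 - a\<^sup>2)\<^sup>2"
  shows "norm z \<le> 1"
proof (rule ccontr)
  assume "\<not> norm z \<le> 1"
  define N where "N = (Re z)\<^sup>2 + (Im z)\<^sup>2"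
  have N: "N > 1"
    using \<open>\<not> norm z \<le> 1\<close> by (simp add: N_def cmod_def)
  have "z \<noteq> 0" using \<open>\<not> norm z \<le> 1\<close> by auto
  then have "w = of_real a / z" using prod by (simp add: field_simps)
  then have Re_s: "Re s = Re z * (1 + a / N)" and Im_s: "Im s = Im z * (1 - a / N)"
    using N by (auto simp: sum[symmetric] Re_divide Im_divide N_def field_simps)
  have a2: "a\<^sup>2 < 1" using a by (simp add: abs_square_less_1)
  define d where "d = (N - 1) * (1 - a\<^sup>2 / N)"
  have "d > 0"
    unfolding d_def using N a2 by (intro mult_pos_pos) (auto simp: field_simps)
  have plus: "N * (1 + a / N)\<^sup>2 = (1 + a)\<^sup>2 + d" and minus: "N * (1 - a / N)\<^sup>2 = (1 - a)\<^sup>2 + d"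
    using N by (simp_all add: d_def field_simps power2_eq_square)
  define e where "e = (1 - a)\<^sup>2 * (Re z)\<^sup>2 + (1 + a)\<^sup>2 * (Im z)\<^sup>2"
  have "e > 0"
  proof -
    have "(1 - a)\<^sup>2 > 0" "(1 + a)\<^sup>2 > 0" using a by auto
    moreover have "Re z \<noteq> 0 \<or> Im z \<noteq> 0"
      using \<open>z \<noteq> 0\<close> by (simp add: complex_eq_iff)
    ultimately show ?thesis
      unfolding e_def by (auto intro: add_pos_nonneg add_nonneg_pos)
  qed
  have "N * ((1 - a)\<^sup>2 * (Re s)\<^sup>2 + (1 + a)\<^sup>2 * (Im s)\<^sup>2)
      = (1 - a)\<^sup>2 * (Re z)\<^sup>2 * (N * (1 + a / N)\<^sup>2) + (1 + a)\<^sup>2 * (Im z)\<^sup>2 * (N * (1 - a / N)\<^sup>2)"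
    by (simp only: Re_s Im_s power_mult_distrib distrib_left[of N] mult_ac)
  also have "\<dots> = N * (1 - a\<^sup>2)\<^sup>2 + d * e"
    unfolding plus minus by (simp add: N_def e_def) algebra
  also have "\<dots> > N * (1 - a\<^sup>2)\<^sup>2"
    using \<open>d > 0\<close> \<open>e > 0\<close> by simp
  finally show False
    using s N by (simp add: mult_less_cancel_left)
qed

text \<open>
  Eliminating \<open>Im w\<close> by \<open>(Im w)\<^sup>2 \<le> Re w - (Re w)\<^sup>2\<close> leaves a quadratic in \<open>p = Re w\<close>, which has
  the root \<open>p = 1\<close> because the disc touches the ellipse there. The cofactor
  \<open>(1 - a) (1 + 3 a) - 4 a p\<close> is affine, with the values \<open>(1 - a) (1 + 3 a)\<close> at \<open>p = 0\<close> and
  \<open>(1 + a) (1 - 3 a)\<close> at \<open>p = 1\<close>; these produce the two bounds on \<open>a\<close>.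
\<close>

lemma disc_in_ellipse:
  fixes w s :: complex and a :: real
  assumes w: "(Re w)\<^sup>2 + (Im w)\<^sup>2 \<le> Re w" and a: "\<bar>a\<bar> \<le> 1 / 3"
    and s: "s = of_real (2 * a) + of_real (1 - a) * w"
  shows "(1 - a)\<^sup>2 * (Re s)\<^sup>2 + (1 + a)\<^sup>2 * (Im s)\<^sup>2 \<le> (1 - a\<^sup>2)\<^sup>2"
proof -
  define p where "p = Re w"
  have q: "(Im w)\<^sup>2 \<le> p - p\<^sup>2" using w by (simp add: p_def)
  have p: "0 \<le> p" "p \<le> 1"
  proof -
    show "0 \<le> p"
      using w by (simp add: p_def) (smt (verit) zero_le_power2)
    have "p * p \<le> p * 1"
      using w by (simp add: p_def power2_eq_square) (smt (verit) zero_le_square)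
    then show "p \<le> 1"
      using \<open>0 \<le> p\<close> by (cases "p = 0") auto
  qed
  have Re_s: "Re s = 2 * a + (1 - a) * p" and Im_s: "Im s = (1 - a) * Im w"
    by (simp_all add: s p_def)
  have "(1 - p) * ((1 - a) * (1 + 3 * a)) \<ge> 0" "p * ((1 + a) * (1 - 3 * a)) \<ge> 0"
    using p a by (intro mult_nonneg_nonneg; linarith)+
  then have cofactor: "(1 - a) * (1 + 3 * a) - 4 * a * p \<ge> 0"
    by (simp add: algebra_simps)
  have "(1 - a)\<^sup>2 * (Re s)\<^sup>2 + (1 + a)\<^sup>2 * (Im s)\<^sup>2
      = (1 - a)\<^sup>2 * ((2 * a + (1 - a) * p)\<^sup>2 + (1 + a)\<^sup>2 * (Im w)\<^sup>2)"
    unfolding Re_s Im_s by algebra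
  also have "\<dots> \<le> (1 - a)\<^sup>2 * ((2 * a + (1 - a) * p)\<^sup>2 + (1 + a)\<^sup>2 * (p - p\<^sup>2))"
    using q by (intro mult_left_mono add_left_mono) auto
  also have "\<dots> = (1 - a\<^sup>2)\<^sup>2 - (1 - a)\<^sup>2 * ((1 - p) * ((1 - a) * (1 + 3 * a) - 4 * a * p))"
    by algebra
  also have "\<dots> \<le> (1 - a\<^sup>2)\<^sup>2"
    using cofactor p by simp
  finally show ?thesis .
qed

lemma inverse_one_minus_in_disc:
  fixes \<mu> :: complex
  assumes "Re \<mu> \<le> 0"
  shows "(Re (1 / (1 - \<mu>)))\<^sup>2 + (Im (1 / (1 - \<mu>)))\<^sup>2 \<le> Re (1 / (1 - \<mu>))"
proof -
  define N where "N = (1 - Re \<mu>)\<^sup>2 + (Im \<mu>)\<^sup>2"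
  have "N > 0" using assms by (simp add: N_def add_pos_nonneg)
  have "(Re (1 / (1 - \<mu>)))\<^sup>2 + (Im (1 / (1 - \<mu>)))\<^sup>2 = (norm (1 / (1 - \<mu>)))\<^sup>2"
    by (simp add: cmod_power2)
  also have "\<dots> = 1 / N"
    by (simp add: norm_divide power_divide cmod_power2 N_def)
  also have "\<dots> \<le> (1 - Re \<mu>) / N"
    using assms \<open>N > 0\<close> by (intro divide_right_mono) auto
  also have "\<dots> = Re (1 / (1 - \<mu>))"
    by (simp add: Re_divide N_def)
  finally show ?thesis .
qed

text \<open>
  The ellipse condition allows roots on the unit circle, but not two of them, since their product
  has modulus \<open>\<bar>a\<bar> < 1\<close>; the other root serves as the contraction factor.
\<close>

lemma bounded_recurrence_if_coeff_in_ellipse: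
  fixes u :: "nat \<Rightarrow> complex" and s :: complex and a :: real
  assumes rec: "\<And>n. u (Suc (Suc n)) = s * u (Suc n) - of_real a * u n"
    and a: "\<bar>a\<bar> < 1"
    and s: "(1 - a)\<^sup>2 * (Re s)\<^sup>2 + (1 + a)\<^sup>2 * (Im s)\<^sup>2 \<le> (1 - a\<^sup>2)\<^sup>2"
  shows "bounded (range u)"
proof -
  obtain z1 z2 where z: "z1 + z2 = s" "z1 * z2 = of_real a"
    by (rule quadratic_roots_exist)
  have le: "norm z1 \<le> 1" "norm z2 \<le> 1"
    using norm_le_1_if_coeff_in_ellipse[of z1 z2 s a] norm_le_1_if_coeff_in_ellipse[of z2 z1 s a]
      z a s by (simp_all add: add.commute mult.commute)
  have "norm z1 * norm z2 = \<bar>a\<bar>"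
    using z(2) by (metis norm_mult norm_of_real)
  then have "norm z1 < 1 \<or> norm z2 < 1"
    using a le by (metis antisym_conv1 less_irrefl mult_1)
  then show ?thesis
  proof
    assume "norm z2 < 1"
    then show ?thesis
      using rec le by (intro bounded_recurrence[of u z1 z2]) (simp_all add: z)
  next
    assume "norm z1 < 1"
    then show ?thesis
      using rec le z by (intro bounded_recurrence[of u z2 z1]) (simp_all add: add.commute mult.commute)
  qed
qed

lemma A_stable_nu_method:
  assumes "\<bar>\<nu>\<bar> \<le> 2 / 3"
  shows "A_stable (nu_method \<nu>)"
  unfolding A_stable_def
proof (intro allI impI)
  fix c :: complex and k t0 :: real and y :: "nat \<Rightarrow> complex"
  assume c: "Re c \<le> 0" and k: "k > 0"
    and sol: "numerical_solution (nu_method \<nu>) k t0 (\<lambda>t u. c * u) y"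
  define a where "a = \<nu> / 2"
  have a: "\<bar>a\<bar> \<le> 1 / 3" and "a \<noteq> 1" using assms by (auto simp: a_def)
  define \<mu> where "\<mu> = of_real k * c"
  have \<mu>: "Re \<mu> \<le> 0" using c k by (simp add: \<mu>_def mult_nonneg_nonpos)
  then have "1 - \<mu> \<noteq> 0" by (auto simp: complex_eq_iff)
  define w where "w = 1 / (1 - \<mu>)"
  define s where "s = of_real (2 * a) + of_real (1 - a) * w"
  have "y (Suc (Suc n)) = s * y (Suc n) - of_real a * y n" for n
  proof -
    define b where "b = complex_of_real (1 / (1 - a))"
    have "b \<noteq> 0" using \<open>a \<noteq> 1\<close> by (simp add: b_def)
    have "b * y (Suc (Suc n)) - b * (1 + of_real a) * y (Suc n) + b * of_real a * y n
        = \<mu> * (b * y (Suc (Suc n)) - b * (2 * of_real a) * y (Suc n) + b * of_real a * y n)"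
      using sol[unfolded numerical_solution_def, rule_format, of "Suc n"]
      by (simp add: nu_method_def scaleR_conv_of_real a_def b_def \<mu>_def mult.assoc)
    then have "b * (y (Suc (Suc n)) - (1 + of_real a) * y (Suc n) + of_real a * y n)
        = b * (\<mu> * (y (Suc (Suc n)) - 2 * of_real a * y (Suc n) + of_real a * y n))"
      by (simp add: algebra_simps)
    then have step: "y (Suc (Suc n)) - (1 + of_real a) * y (Suc n) + of_real a * y n
        = \<mu> * (y (Suc (Suc n)) - 2 * of_real a * y (Suc n) + of_real a * y n)"
      using \<open>b \<noteq> 0\<close> by simp
    \<comment> \<open>The \<open>\<alpha>\<close>- and \<open>\<beta>\<close>-combinations differ only by \<open>(1 - a) y\<^sub>n\<^sub>+\<^sub>1\<close>, so \<open>\<mu>\<close> enters \<open>s\<close> only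
      through \<open>w\<close>, and linearly in \<open>w\<close>.\<close>
    have "(1 - \<mu>) * (y (Suc (Suc n)) - 2 * of_real a * y (Suc n) + of_real a * y n)
        = of_real (1 - a) * y (Suc n)"
      using step by (simp add: algebra_simps)
    then have "y (Suc (Suc n)) - 2 * of_real a * y (Suc n) + of_real a * y n
        = w * (of_real (1 - a) * y (Suc n))"
      using \<open>1 - \<mu> \<noteq> 0\<close> by (simp add: w_def field_simps)
    then show ?thesis by (simp add: s_def algebra_simps)
  qed
  moreover have "(1 - a)\<^sup>2 * (Re s)\<^sup>2 + (1 + a)\<^sup>2 * (Im s)\<^sup>2 \<le> (1 - a\<^sup>2)\<^sup>2"
    using disc_in_ellipse[OF inverse_one_minus_in_disc[OF \<mu>] a] by (simp add: s_def w_def)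
  ultimately show "bounded (range y)"
    using a by (intro bounded_recurrence_if_coeff_in_ellipse[of y s a]) auto
qed

lemma zero_stable_nu_method_iff:
  assumes "\<nu> \<noteq> 2"
  shows "zero_stable (nu_method \<nu>) \<longleftrightarrow> -2 \<le> \<nu> \<and> \<nu> < 2"
proof -
  define a where "a = complex_of_real (\<nu> / 2)"
  define b where "b = complex_of_real (1 / (1 - \<nu> / 2))"
  define P where "P = first_char_poly (nu_method \<nu>)"
  have "b \<noteq> 0" "a \<noteq> 1" using assms by (auto simp: a_def b_def complex_eq_iff)
  have P: "P = smult b ([:-1, 1:] * [:-a, 1:])"
    using assms
    by (simp add: P_def first_char_poly_def nu_method_def a_def b_def add_divide_distrib diff_divide_distrib)
  have roots: "poly P z = 0 \<longleftrightarrow> z = 1 \<or> z = a" for z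
  proof -
    have "poly P z = b * ((z - 1) * (z - a))"
      by (simp add: P algebra_simps)
    then show ?thesis using \<open>b \<noteq> 0\<close> by simp
  qed
  have order_linear: "order z [:-r, 1:] = (if z = r then 1 else 0)" for z r :: complex
    using order_power_n_n[of r 1] by (auto intro: order_0I)
  have simple: "order z P = 1" if "z = 1 \<or> z = a" for z
    using that \<open>b \<noteq> 0\<close> \<open>a \<noteq> 1\<close> unfolding P
    by (subst order_smult, simp, subst order_mult) (auto simp: order_linear)
  have "norm a = \<bar>\<nu>\<bar> / 2" unfolding a_def norm_of_real by simp
  have "zero_stable (nu_method \<nu>) \<longleftrightarrow> norm a \<le> 1"
    unfolding zero_stable_def P_def[symmetric] roots using simple by auto
  also have "\<dots> \<longleftrightarrow> -2 \<le> \<nu> \<and> \<nu> < 2"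
    using assms \<open>norm a = \<bar>\<nu>\<bar> / 2\<close> by auto
  finally show ?thesis .
qed

theorem proposition2p2:
  fixes \<nu> :: real
  assumes "\<nu> \<noteq> 2"
  shows "(-2 \<le> \<nu> \<and> \<nu> < 2 \<longrightarrow> zero_stable (nu_method \<nu>)) \<and>
         (\<not> (-2 \<le> \<nu> \<and> \<nu> < 2) \<longrightarrow> zero_unstable (nu_method \<nu>)) \<and>
         (-2 \<le> \<nu> \<and> \<nu> < 2 \<longrightarrow>
            (-(2/3) \<le> \<nu> \<and> \<nu> \<le> 2/3 \<longrightarrow> A_stable (nu_method \<nu>)))"
  using zero_stable_nu_method_iff[OF assms] A_stable_nu_method[of \<nu>] by auto

end
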